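(* Let $p$ be a power of $2$, $q$ a power of $p$, $\mathbb{F}$ an algebraic closure of $\mathbb{F}_q$, $e\ge1$, and let $F(x)=\sum_{i=0}^eb_ix^{p^i}\in\mathbb{F}_q[x]$ satisfy: (i) $b_0b_e\ne0$; (ii) $F^\ast(1)=0$; (iii) $W_F^\ast:=\{x\in\mathbb{F}\mid F^\ast(x)=0\}\subset\mathbb{F}_q$; (iv) $\{x\in\mathbb{F}\mid F^\ast(F(x))=0\}\subset\mathbb{F}_q$. Put $R:=R_F$. Then (1) $\mathbb{F}_q=S_0\sqcup S_{F,-}\sqcup S_{F,+}$; (2) $\alpha_F(S_0)\subset T_{R,0}$, $\alpha_F(S_{F,-})=T_{R,\max}$, and $\alpha_F(S_{F,+})=T_{R,\min}$.
   Context: $F^\ast(x):=\sum_{i=0}^e(b_ix)^{p^{-i}}$ for $x\in\mathbb{F}$. $R_F(x):=\sum_{i=1}^ea_ix^{p^i}$ with $a_i:=\sum_{j=0}^{e-i}(b_jb_{j+i})^{p^{-j}}$; $\gamma_F:=\sum_{0\le i<j\le e}b_i^{p^{-i}}b_j^{p^{-j}}$; $\alpha_F(t):=\gamma_F+F^\ast(t)^2$ for $t\in\mathbb{F}_q$. For $a\in\mathbb{F}_q$ let $C_a$ be the affine curve $y^p-y=x(R(x)+ax)$. Define $T_{R,0}:=\{a\in\mathbb{F}_q: |C_a(\mathbb{F}_q)|=q\}$, $T_{R,\max}:=\{a: |C_a(\mathbb{F}_q)|=q+(p-1)p^e\sqrt q\}$, $T_{R,\min}:=\{a:|C_a(\mathbb{F}_q)|=q-(p-1)p^e\sqrt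 q\}$. Let $\ell$ be an odd prime, fix a primitive 4th root of unity $\sqrt{-1}\in\overline{\mathbb{Q}}_\ell$, and let $\xi_2$ be the character of $W_2(\mathbb{F}_2)\cong\mathbb{Z}/4$ (Witt vectors of length $2$, addition $(a,b)+(c,d)=(a+c,b+d+ac)$) with $\xi_2(1,0)=\sqrt{-1}$. For $x\in\mathbb{F}_q$, $q=2^n$, let $Q_q(x):=\xi_2\big(\sum_{i=0}^{n-1}(x^{2^i},0)\big)$ (Witt sum) and $\psi_q(x):=(-1)^{\mathrm{Tr}_{\mathbb{F}_q/\mathbb{F}_2}(x)}$. Set $S_F:=\{t\in\mathbb{F}_q\mid Q_q(v)=\psi_q(tv)\ \forall v\in W_F^\ast\}$, $S_0:=\mathbb{F}_q\setminus S_F$, $S_{F,-}:=\{t\in S_F\mid Q_q(t)=-(\sqrt{-1})^{[\mathbb{F}_q:\mathbb{F}_2]/2}\}$, $S_{F,+}:=\{t\in S_F\mid Q_q(t)=(\sqrt{-1})^{[\mathbb{F}_q:\mathbb{F}_2]/2}\}$ (under the hypotheses $[\mathbb{F}_q:\mathbb{F}_p]$ is even). *)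

theory Defs
  imports
    Complex_Main
    "HOL-Library.Cardinality"
    "HOL-Computational_Algebra.Computational_Algebra"
    "HOL-Algebra.Algebraic_Closure_Type"
begin

text \<open>
  The finite field of cardinality \<open>q\<close> is a type \<open>'a\<close> with \<open>CARD('a) = q\<close>, and its algebraic
  closure is the library type \<open>'a alg_closure\<close>, with embedding \<^const>\<open>to_ac\<close>. The polynomial
  \<open>F\<close> is given by \<open>e\<close> and the coefficients \<open>b 0, \<dots>, b e\<close>; values \<open>b i\<close> with \<open>i > e\<close> play no role.
  In these definitions \<open>p\<close> is a power of the characteristic, not necessarily the characteristic.
\<close>

definition F_poly :: "nat \<Rightarrow> nat \<Rightarrow> (nat \<Rightarrow> 'a::field) \<Rightarrow> 'a poly" where
  "F_poly p e b = (\<Sum>i\<le>e. monom (b i) (p ^ i))"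

text \<open>
  The element written $x^{p^{-i}}$. It is meaningful because the Frobenius map is bijective both
  on a finite field and on its algebraic closure.
\<close>

definition frob_root :: "nat \<Rightarrow> nat \<Rightarrow> 'a::field \<Rightarrow> 'a" where
  "frob_root p i = inv_into UNIV (\<lambda>y. y ^ (p ^ i))"

text \<open>
  Polymorphic, so that it gives the function both on the finite field (coefficients \<open>b\<close>) and on
  the algebraic closure (coefficients \<open>to_ac \<circ> b\<close>).
\<close>

definition F_star :: "nat \<Rightarrow> nat \<Rightarrow> (nat \<Rightarrow> 'a::field) \<Rightarrow> 'a \<Rightarrow> 'a" where
  "F_star p e b x = (\<Sum>i\<le>e. frob_root p i (b i * x))"

definition W_star :: "nat \<Rightarrow> nat \<Rightarrow> (nat \<Rightarrow> 'a::field) \<Rightarrow> 'a alg_closure set" where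
  "W_star p e b = {x. F_star p e (to_ac \<circ> b) x = 0}"

definition R_coeff :: "nat \<Rightarrow> nat \<Rightarrow> (nat \<Rightarrow> 'a::field) \<Rightarrow> nat \<Rightarrow> 'a" where
  "R_coeff p e b i = (\<Sum>j\<le>e - i. frob_root p j (b j * b (j + i)))"

definition R_poly :: "nat \<Rightarrow> nat \<Rightarrow> (nat \<Rightarrow> 'a::field) \<Rightarrow> 'a poly" where
  "R_poly p e b = (\<Sum>i=1..e. monom (R_coeff p e b i) (p ^ i))"

definition gamma_F :: "nat \<Rightarrow> nat \<Rightarrow> (nat \<Rightarrow> 'a::field) \<Rightarrow> 'a" where
  "gamma_F p e b =
     (\<Sum>(i, j)\<in>{(i, j). i < j \<and> j \<le> e}. frob_root p i (b i) * frob_root p j (b j))"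

definition alpha_F :: "nat \<Rightarrow> nat \<Rightarrow> (nat \<Rightarrow> 'a::field) \<Rightarrow> 'a \<Rightarrow> 'a" where
  "alpha_F p e b t = gamma_F p e b + (F_star p e b t)\<^sup>2"

definition curve_points :: "nat \<Rightarrow> 'a::field poly \<Rightarrow> 'a \<Rightarrow> ('a \<times> 'a) set" where
  "curve_points p R a = {(x, y). y ^ p - y = x * (poly R x + a * x)}"

definition T_zero :: "nat \<Rightarrow> nat \<Rightarrow> 'a::field poly \<Rightarrow> 'a set" where
  "T_zero p q R = {a. card (curve_points p R a) = q}"

definition T_max :: "nat \<Rightarrow> nat \<Rightarrow> nat \<Rightarrow> 'a::field poly \<Rightarrow> 'a set" where
  "T_max p q e R =
     {a. real (card (curve_points p R a)) = real q + (real p - 1) * real p ^ e * sqrt (real q)}"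

definition T_min :: "nat \<Rightarrow> nat \<Rightarrow> nat \<Rightarrow> 'a::field poly \<Rightarrow> 'a set" where
  "T_min p q e R =
     {a. real (card (curve_points p R a)) = real q - (real p - 1) * real p ^ e * sqrt (real q)}"

text \<open>
  Witt vectors of length 2 for the prime 2, over rings of characteristic 2, which is the only
  case used below. (Over a general ring the last term of the second component of a sum would be
  $-ac$; the formula below still defines an abelian group.)
\<close>

datatype 'a witt2 = Witt 'a 'a

instantiation witt2 :: (comm_ring_1) ab_group_add
begin

definition zero_witt2 :: "'a witt2" where
  "zero_witt2 = Witt 0 0"

fun plus_witt2 :: "'a witt2 \<Rightarrow> 'a witt2 \<Rightarrow> 'a witt2" where
  "plus_witt2 (Witt a b) (Witt c d) = Witt (a + c) (b + d + a * c)"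

fun uminus_witt2 :: "'a witt2 \<Rightarrow> 'a witt2" where
  "uminus_witt2 (Witt a b) = Witt (- a) (a * a - b)"

definition minus_witt2 :: "'a witt2 \<Rightarrow> 'a witt2 \<Rightarrow> 'a witt2" where
  "minus_witt2 u v = u + (- v)"

instance
proof
  fix u v w :: "'a witt2"
  show "u + v + w = u + (v + w)"
    by (cases u; cases v; cases w) (simp add: algebra_simps)
  show "u + v = v + u"
    by (cases u; cases v) (simp add: algebra_simps)
  show "0 + u = u"
    by (cases u) (simp add: zero_witt2_def)
  show "- u + u = 0"
    by (cases u) (simp add: zero_witt2_def)
  show "u - v = u + - v"
    by (simp add: minus_witt2_def)
qed

end

text \<open>
  The Witt vectors over the prime field, as a subgroup of the Witt vectors over a field of
  characteristic 2.
\<close>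

definition W2_F2 :: "'a::field witt2 set" where
  "W2_F2 = {Witt x y | x y. x \<in> {0, 1} \<and> y \<in> {0, 1}}"

definition is_W2_F2_character :: "('a::field witt2 \<Rightarrow> 'k::field) \<Rightarrow> bool" where
  "is_W2_F2_character \<xi> \<longleftrightarrow>
     (\<forall>u\<in>W2_F2. \<xi> u \<noteq> 0) \<and> (\<forall>u\<in>W2_F2. \<forall>v\<in>W2_F2. \<xi> (u + v) = \<xi> u * \<xi> v)"

definition primitive_4th_root :: "'k::field \<Rightarrow> bool" where
  "primitive_4th_root \<iota> \<longleftrightarrow> \<iota> ^ 4 = 1 \<and> (\<forall>k. 0 < k \<and> k < 4 \<longrightarrow> \<iota> ^ k \<noteq> 1)"

text \<open>
  From here on \<open>n\<close> is the degree of the finite field over its prime field, and \<open>\<xi>\<close> is the chosen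
  character of \<^const>\<open>W2_F2\<close>. The Witt sum in \<open>Q_q\<close> is invariant under Frobenius, hence lies in
  \<^const>\<open>W2_F2\<close>.
\<close>

definition Q_q :: "nat \<Rightarrow> ('a::field witt2 \<Rightarrow> 'k::field) \<Rightarrow> 'a \<Rightarrow> 'k" where
  "Q_q n \<xi> x = \<xi> (\<Sum>i<n. Witt (x ^ (2 ^ i)) 0)"

text \<open>
  The trace to the prime field, as the sum of the Galois conjugates; its values are \<open>0\<close> and \<open>1\<close>
  in the finite field.
\<close>

definition trace_F2 :: "nat \<Rightarrow> 'a::field \<Rightarrow> 'a" where
  "trace_F2 n x = (\<Sum>i<n. x ^ (2 ^ i))"

definition psi_q :: "nat \<Rightarrow> 'a::field \<Rightarrow> 'k::field" where
  "psi_q n x = (if trace_F2 n x = 0 then 1 else - 1)"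

definition S_F ::
  "nat \<Rightarrow> nat \<Rightarrow> nat \<Rightarrow> (nat \<Rightarrow> 'a::field) \<Rightarrow> ('a witt2 \<Rightarrow> 'k::field) \<Rightarrow> 'a set" where
  "S_F p n e b \<xi> = {t. \<forall>v. to_ac v \<in> W_star p e b \<longrightarrow> Q_q n \<xi> v = psi_q n (t * v)}"

definition S_zero ::
  "nat \<Rightarrow> nat \<Rightarrow> nat \<Rightarrow> (nat \<Rightarrow> 'a::field) \<Rightarrow> ('a witt2 \<Rightarrow> 'k::field) \<Rightarrow> 'a set" where
  "S_zero p n e b \<xi> = UNIV - S_F p n e b \<xi>"

text \<open>
  Here \<open>\<iota>\<close> is the chosen square root of \<open>-1\<close>. The exponent \<open>n div 2\<close> is only meant for even \<open>n\<close>;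
  the hypotheses imposed on \<open>F\<close> force \<open>n\<close> to be even.
\<close>

definition S_minus ::
  "nat \<Rightarrow> nat \<Rightarrow> nat \<Rightarrow> (nat \<Rightarrow> 'a::field) \<Rightarrow> ('a witt2 \<Rightarrow> 'k::field) \<Rightarrow> 'k \<Rightarrow> 'a set" where
  "S_minus p n e b \<xi> \<iota> = {t \<in> S_F p n e b \<xi>. Q_q n \<xi> t = - (\<iota> ^ (n div 2))}"

definition S_plus ::
  "nat \<Rightarrow> nat \<Rightarrow> nat \<Rightarrow> (nat \<Rightarrow> 'a::field) \<Rightarrow> ('a witt2 \<Rightarrow> 'k::field) \<Rightarrow> 'k \<Rightarrow> 'a set" where
  "S_plus p n e b \<xi> \<iota> = {t \<in> S_F p n e b \<xi>. Q_q n \<xi> t = \<iota> ^ (n div 2)}"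

end

theory Submission
  imports Defs "HOL-Number_Theory.Residues"
begin

text \<open>
  Counting with additive characters gives \<open>card C\<^sub>a = q + (p - 1) S(a)\<close> with
  \<open>S(a) = \<Sum>\<^sub>x \<psi>(x R(x) + a x\<^sup>2)\<close>. The Witt vector character satisfies
  \<open>Q(x + y) = Q(x) Q(y) \<psi>(x y)\<close> and is invariant under Frobenius, so expanding \<open>Q(F(x))\<close> and using
  \<open>F\<^sup>*(1) = 0\<close> gives \<open>Q(F(x)) = \<psi>(x R(x) + \<gamma> x\<^sup>2)\<close>. As \<open>F\<^sup>*\<close> is the adjoint of \<open>F\<close> for the trace
  form, \<open>S(\<alpha>(t)) = \<Sum>\<^sub>x Q(F(x)) \<psi>(t F(x))\<close>, which by Poisson summation over the kernel \<open>V\<close> of \<open>F\<^sup>*\<close> is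
  \<open>G(0) / Q(t)\<close> times the sum over \<open>w \<in> V\<close> of \<open>\<psi>(t w) / Q(w)\<close>. Rationality of the kernel of
  \<open>F\<^sup>* \<circ> F\<close> makes \<open>V\<close> isotropic, so the summand is a character of \<open>V\<close>, trivial exactly for
  \<open>t \<in> S\<^sub>F\<close>. The Gauss sum is \<open>G(0) = - \<surd>q \<iota>\<^bsup>n/2\<^esup>\<close>. Finally \<open>S(a) \<noteq> 0\<close> forces a square root of \<open>a - \<gamma>\<close> to be
  orthogonal to the kernel of \<open>F\<close>, hence in the image of \<open>F\<^sup>*\<close>.
\<close>

section \<open>Finite fields of characteristic two\<close>

lemma add_self_CHAR_2:
  fixes x :: "'f::comm_ring_1"
  assumes "CHAR('f) = 2"
  shows "x + x = 0"
  using assms by (metis add.right_inverse uminus_CHAR_2)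

lemma add_eq_0_iff_CHAR_2:
  fixes x y :: "'f::comm_ring_1"
  assumes "CHAR('f) = 2"
  shows "x + y = 0 \<longleftrightarrow> x = y"
  using assms by (metis add_eq_0_iff uminus_CHAR_2)

lemma frob_add:
  fixes x y :: "'f::comm_ring_1"
  assumes "CHAR('f) = 2"
  shows "(x + y) ^ 2 ^ k = x ^ 2 ^ k + y ^ 2 ^ k"
  using assms by (intro freshmans_dream') auto

lemma frob_sum:
  fixes f :: "'b \<Rightarrow> 'f::comm_ring_1"
  assumes "CHAR('f) = 2"
  shows "sum f A ^ 2 ^ k = (\<Sum>i\<in>A. f i ^ 2 ^ k)"
  using assms by (intro freshmans_dream_sum') auto

lemma frob_inj:
  assumes "CHAR('f::field) = 2"
  shows "inj (\<lambda>x::'f. x ^ 2 ^ k)"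
proof (rule injI)
  fix x y :: 'f
  assume "x ^ 2 ^ k = y ^ 2 ^ k"
  then have "(x + y) ^ 2 ^ k = 0"
    using assms by (simp add: frob_add add_self_CHAR_2)
  then show "x = y"
    using assms add_eq_0_iff_CHAR_2 by fastforce
qed

lemma frob_surj_finite:
  assumes "CHAR('f::finite_field) = 2"
  shows "surj (\<lambda>x::'f. x ^ 2 ^ k)"
  using frob_inj[OF assms] finite_UNIV_inj_surj[of "\<lambda>x::'f. x ^ 2 ^ k"] by simp

lemma frob_surj_alg_closed: "surj (\<lambda>x::'f::alg_closed_field. x ^ 2 ^ k)"
  unfolding surj_def using nth_root_exists[of "2 ^ k"] by (metis zero_less_numeral zero_less_power)

lemma frob_root_power:
  fixes x :: "'f::field"
  assumes "surj (\<lambda>x::'f. x ^ (p ^ i))"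
  shows "frob_root p i x ^ (p ^ i) = x"
  unfolding frob_root_def using surj_f_inv_f[OF assms] .

lemma frob_root_eqI:
  fixes x :: "'f::field"
  assumes "inj (\<lambda>x::'f. x ^ (p ^ i))" "y ^ (p ^ i) = x"
  shows "frob_root p i x = y"
  unfolding frob_root_def using inv_f_eq[OF assms] .

text \<open>A double root of \<open>P\<close> would also be a zero of its derivative, so all roots
  are simple and a complete factorization has \<open>degree P\<close> distinct factors.\<close>

lemma card_roots_pderiv_const:
  fixes P :: "'f::alg_closed_field poly"
  assumes "pderiv P = [:c:]" "c \<noteq> 0"
  shows "card {x. poly P x = 0} = degree P"
proof -
  have P0: "P \<noteq> 0"
    using assms by auto
  obtain A where A: "size A = degree P" "P = smult (lead_coeff P) (\<Prod>x\<in>#A. [:-x, 1:])"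
    using alg_closed_imp_factorization[OF P0] by blast
  define l where "l = lead_coeff P"
  have P: "P = smult l (\<Prod>x\<in>#A. [:-x, 1:])" and "l \<noteq> 0"
    using A(2) P0 by (simp_all add: l_def)
  have simple: "count A x \<le> 1" for x
  proof (rule ccontr)
    assume "\<not> count A x \<le> 1"
    then have "2 \<le> count A x"
      by simp
    then obtain B where "A = add_mset x (add_mset x B)"
      unfolding count_le_replicate_mset_subset_eq
      by (auto simp: mset_subset_eq_exists_conv numeral_2_eq_2)
    then have "P = [:-x, 1:] * ([:-x, 1:] * smult l (\<Prod>x\<in>#B. [:-x, 1:]))"
      unfolding P by (simp only: image_mset_add_mset mult_smult_right prod_mset.add_mset)
    then obtain U where U: "P = [:-x, 1:] * ([:-x, 1:] * U)"
      by blast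
    have "poly (pderiv P) x = 0"
      unfolding U pderiv_mult poly_add poly_mult by simp
    then show False
      using assms by simp
  qed
  have "{x. poly P x = 0} = set_mset A"
    unfolding P using \<open>l \<noteq> 0\<close> by (auto simp: poly_prod_mset)
  also have "card (set_mset A) = size A"
    using simple
    by (metis (no_types, lifting) count_greater_eq_one_iff card_eq_sum le_antisym
        size_multiset_overloaded_eq sum.cong)
  finally show ?thesis
    using A by simp
qed

locale binary_field =
  fixes n :: nat and type_a :: "'a::finite_field itself"
  assumes card_UNIV: "CARD('a) = 2 ^ n"
begin

lemma CHAR_2: "CHAR('a) = 2"
proof -
  have "CHAR('a) dvd 2 ^ n"
    using CHAR_dvd_CARD[where ?'a = 'a] card_UNIV by simp
  then have "CHAR('a) dvd 2"
    using prime_dvd_power[OF CHAR_prime] by blast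
  then show ?thesis
    using CHAR_prime[where ?'a = 'a] primes_dvd_imp_eq two_is_prime_nat by blast
qed

lemma CHAR_2_closure: "CHAR('a alg_closure) = 2"
  using CHAR_2 by simp

lemma n_pos: "n > 0"
proof (rule ccontr)
  assume "\<not> n > 0"
  then have "CARD('a) = 1"
    using card_UNIV by simp
  then obtain u :: 'a where "UNIV = {u}"
    by (metis card_1_singletonE)
  then have "(0::'a) = 1"
    by (metis UNIV_I singletonD)
  then show False
    by simp
qed

lemmas add_self [simp] = add_self_CHAR_2[where ?'f = 'a, OF CHAR_2]
lemmas uminus_eq [simp] = uminus_CHAR_2[where ?'a = 'a, OF CHAR_2]

lemma minus_eq_add [simp]: "x - y = x + (y :: 'a)"
  by (metis diff_conv_add_uminus uminus_eq)

lemma two_eq_0 [simp]: "(2 :: 'a) = 0"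
  by (metis one_add_one add_self)

lemma add_eq_0_iff [simp]: "x + y = 0 \<longleftrightarrow> x = (y :: 'a)"
  by (rule add_eq_0_iff_CHAR_2[OF CHAR_2])

lemma add_self_left [simp]: "x + (x + y) = (y :: 'a)"
  by (metis add.assoc add_0 add_self)

lemmas frob = frob_add[where ?'f = 'a, OF CHAR_2]

lemma power_card [simp]: "x ^ 2 ^ n = (x :: 'a)"
  using finite_field_power_card_eq_same[of x] card_UNIV by simp

lemma frob_root_power_finite [simp]: "frob_root (2 ^ s) i x ^ 2 ^ (s * i) = (x :: 'a)"
  using frob_root_power[of "2 ^ s" i x] frob_surj_finite[OF CHAR_2, of "s * i"]
  by (simp flip: power_mult)

lemma to_ac_frob_root: "to_ac (frob_root (2 ^ s) i (x :: 'a)) = frob_root (2 ^ s) i (to_ac x)"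
proof (rule sym, rule frob_root_eqI)
  show "inj (\<lambda>x::'a alg_closure. x ^ (2 ^ s) ^ i)"
    using frob_inj[OF CHAR_2_closure] by (simp flip: power_mult)
  show "to_ac (frob_root (2 ^ s) i x) ^ (2 ^ s) ^ i = to_ac x"
    by (simp flip: power_mult to_ac_power)
qed

section \<open>The absolute trace and its bilinear form\<close>

abbreviation tr :: "'a \<Rightarrow> 'a" where "tr \<equiv> trace_F2 n"

lemma tr_add: "tr (x + y) = tr x + tr y"
  by (simp add: trace_F2_def frob sum.distrib)

lemma tr_0 [simp]: "tr 0 = 0"
  by (simp add: trace_F2_def power_0_left)

lemma tr_sum: "tr (sum f A) = (\<Sum>i\<in>A. tr (f i))"
  by (induction A rule: infinite_finite_induct) (auto simp: tr_add)

lemma sum_shift: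
  fixes f :: "nat \<Rightarrow> 'b::ab_group_add"
  assumes "f N = f 0"
  shows "(\<Sum>i<N. f (Suc i)) = (\<Sum>i<N. f i)"
  using sum.lessThan_Suc_shift[of f N] sum.lessThan_Suc[of f N] assms
  by (simp add: add.commute)

lemma tr_square: "tr (x\<^sup>2) = tr x"
  unfolding trace_F2_def
  using sum_shift[of "\<lambda>i. x ^ 2 ^ i" n] by (simp add: power_mult)

lemma tr_frob: "tr (x ^ 2 ^ k) = tr x"
proof (induction k)
  case (Suc k)
  have "x ^ 2 ^ Suc k = (x ^ 2 ^ k)\<^sup>2"
    by (simp add: mult.commute flip: power_mult)
  then show ?case
    using Suc tr_square by simp
qed simp

lemma tr_sqrt_cong: "x ^ 2 ^ k = y \<Longrightarrow> tr x = tr y"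
  using tr_frob by metis

lemma tr_values: "tr x = 0 \<or> tr x = 1"
proof -
  have "(tr x)\<^sup>2 = tr (x\<^sup>2)"
    using frob_sum[OF CHAR_2, of "\<lambda>i. x ^ 2 ^ i" "{..<n}" 1]
    by (simp add: trace_F2_def mult.commute flip: power_mult)
  then have "tr x * (tr x - 1) = 0"
    using tr_square by (simp add: power2_eq_square algebra_simps del: minus_eq_add)
  then show ?thesis
    using mult_eq_0_iff[of "tr x" "tr x - 1"] by auto
qed

text \<open>The trace is a nonzero polynomial of degree at most \<open>2 ^ (n - 1)\<close>, which is
  too small to vanish at all \<open>2 ^ n\<close> elements.\<close>

lemma tr_nontrivial: "\<exists>x. tr x \<noteq> 0"
proof (rule ccontr)
  assume *: "\<not> (\<exists>x. tr x \<noteq> 0)"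
  define P :: "'a poly" where "P = (\<Sum>i<n. monom 1 (2 ^ i))"
  have "coeff P (2 ^ i) = (if i < n then 1 else 0)" for i
    by (auto simp: P_def coeff_sum if_distrib[of "\<lambda>x. x = _"])
  then have "P \<noteq> 0"
    using n_pos by (metis coeff_0 one_neq_zero)
  moreover have "degree P \<le> 2 ^ (n - 1)"
    unfolding P_def
    by (intro degree_sum_le) (auto simp: degree_monom_eq)
  moreover have "poly P x = 0" for x
    using * by (simp add: P_def poly_sum poly_monom trace_F2_def)
  ultimately have "CARD('a) \<le> 2 ^ (n - 1)"
    using card_poly_roots_bound[of P] by simp
  then show False
    using n_pos card_UNIV by (simp add: power_eq_if)
qed

lemma tr_pairing_nondegenerate:
  assumes "a \<noteq> 0"
  shows "\<exists>x. tr (a * x) \<noteq> 0"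
proof -
  obtain y where "tr y \<noteq> 0"
    using tr_nontrivial by blast
  then show ?thesis
    using assms by (intro exI[of _ "y / a"]) simp
qed

text \<open>The embedded field already supplies \<open>2 ^ n\<close> roots of a polynomial of degree
  at most \<open>2 ^ n\<close>. This is the test by which elements of the closure are recognized as
  rational.\<close>

lemma range_to_ac: "{z. z ^ 2 ^ n = z} = range (to_ac :: 'a \<Rightarrow> _)"
proof (rule sym, rule card_seteq)
  define P :: "'a alg_closure poly" where "P = monom 1 (2 ^ n) - monom 1 1"
  have "1 < (2::nat) ^ n"
    using n_pos one_less_power[of "2::nat" n] by simp
  then have "coeff P (2 ^ n) = 1"
    by (simp add: P_def)
  then have P0: "P \<noteq> 0"
    by auto
  have roots: "{z. z ^ 2 ^ n = z} = {z. poly P z = 0}"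
    by (simp add: P_def poly_monom)
  show "finite {z :: 'a alg_closure. z ^ 2 ^ n = z}"
    unfolding roots using poly_roots_finite[OF P0] .
  have "degree P \<le> 2 ^ n"
    unfolding P_def by (intro degree_diff_le) (auto simp: degree_monom_eq)
  then show "card {z :: 'a alg_closure. z ^ 2 ^ n = z} \<le> card (range (to_ac :: 'a \<Rightarrow> _))"
    unfolding roots using card_poly_roots_bound[OF P0]
    by (simp add: card_image inj_to_ac card_UNIV)
qed (auto simp flip: to_ac_power)

text \<open>The polynomial \<open>P\<close> has derivative -1, hence \<open>2 ^ r\<close> distinct
  roots in the closure; since \<open>r\<close> divides \<open>n\<close>, the Frobenius power for
  \<open>n\<close> fixes them and they are rational.\<close>

lemma card_subfield:
  assumes "r > 0" "n = r * m"
  shows "card {z :: 'a. z ^ 2 ^ r = z} = 2 ^ r"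
proof -
  define P :: "'a alg_closure poly" where "P = monom 1 (2 ^ r) - monom 1 1"
  have "degree P = 2 ^ r"
    unfolding P_def using assms(1) one_less_power[of "2::nat" r]
    by (subst diff_conv_add_uminus, subst degree_add_eq_left) (auto simp: degree_monom_eq)
  moreover have "pderiv P = [:-1:]"
  proof -
    have "(2 :: 'a alg_closure) = 0"
      using add_self_CHAR_2[OF CHAR_2_closure, of 1] by simp
    then show ?thesis
      unfolding P_def using assms(1) by (simp add: pderiv_diff pderiv_monom monom_0 power_0_left)
  qed
  ultimately have "card {z. poly P z = 0} = 2 ^ r"
    using card_roots_pderiv_const[of P "-1"] by simp
  moreover have "{z. poly P z = 0} = to_ac ` {z :: 'a. z ^ 2 ^ r = z}"
  proof -
    have pow: "z ^ 2 ^ n = z" if "z ^ 2 ^ r = z" for z :: "'a alg_closure"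
    proof -
      have "z ^ 2 ^ (r * k) = z" for k
        by (induction k) (simp_all add: power_add power_mult that)
      then show ?thesis
        using assms by simp
    qed
    have "\<exists>y :: 'a. y ^ 2 ^ r = y \<and> z = to_ac y" if z: "z ^ 2 ^ r = z" for z
    proof -
      have "z \<in> range to_ac"
        using range_to_ac pow[OF z] by blast
      then obtain y where "z = to_ac y"
        by blast
      then show ?thesis
        using z by (auto simp flip: to_ac_power)
    qed
    then show ?thesis
      by (auto simp: P_def poly_monom simp flip: to_ac_power)
  qed
  ultimately show ?thesis
    by (simp add: card_image inj_on_subset[OF inj_to_ac])
qed

end

section \<open>The Witt vector character and its Gauss sum\<close>

lemma sum_lessThan_add:
  fixes f :: "nat \<Rightarrow> 'b::comm_monoid_add"
  shows "(\<Sum>i<h + k. f i) = (\<Sum>i<h. f i) + (\<Sum>i<k. f (h + i))"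
  by (induction k) (simp_all add: add.assoc)

lemma sum_over_fibers:
  fixes g :: "'b::finite \<Rightarrow> 'k::comm_semiring_1" and f :: "'a::finite \<Rightarrow> 'b"
  shows "(\<Sum>y\<in>UNIV. g y * of_nat (card {x. f x = y})) = (\<Sum>x\<in>UNIV. g (f x))"
proof -
  have "g y * of_nat (card {x. f x = y}) = (\<Sum>x\<in>{x. f x = y}. g (f x))" for y
    by (simp add: mult.commute)
  then show ?thesis
    using sum.group[of UNIV UNIV f "\<lambda>x. g (f x)"] by simp
qed

lemma sum_Witt_0:
  fixes f :: "'b \<Rightarrow> 'a::comm_ring_1"
  shows "(\<Sum>i\<in>A. Witt 0 (f i)) = Witt 0 (\<Sum>i\<in>A. f i)"
  by (induction A rule: infinite_finite_induct) (auto simp: zero_witt2_def)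

primrec witt_fst :: "'a witt2 \<Rightarrow> 'a" where
  "witt_fst (Witt a b) = a"

lemma witt_fst_add: "witt_fst (u + v) = witt_fst u + witt_fst v"
  by (cases u; cases v) simp

lemma witt_fst_sum: "witt_fst (sum f A) = (\<Sum>i\<in>A. witt_fst (f i))"
  by (induction A rule: infinite_finite_induct) (auto simp: witt_fst_add zero_witt2_def)

primrec witt_frob :: "'a::comm_ring_1 witt2 \<Rightarrow> 'a witt2" where
  "witt_frob (Witt a b) = Witt (a\<^sup>2) (b\<^sup>2)"

context binary_field
begin

lemma square_add: "(x + y)\<^sup>2 = x\<^sup>2 + (y :: 'a)\<^sup>2"
  using frob[of x y 1] by simp

lemma witt_frob_add: "witt_frob (u + v) = witt_frob u + witt_frob (v :: 'a witt2)"
  by (cases u; cases v) (simp add: square_add power_mult_distrib)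

lemma witt_frob_sum: "witt_frob (sum f A) = (\<Sum>i\<in>A. witt_frob (f i :: 'a witt2))"
  by (induction A rule: infinite_finite_induct) (auto simp: witt_frob_add zero_witt2_def)

lemma square_eq_self_iff: "x\<^sup>2 = x \<longleftrightarrow> x = 0 \<or> x = (1 :: 'a)"
  by (simp add: power2_eq_square)

text \<open>\<open>Witt x 0\<close> is the Teichmueller representative of \<open>x\<close>, and this
  is its trace down to the Witt vectors over the prime field.\<close>

definition witt_trace :: "'a \<Rightarrow> 'a witt2" where
  "witt_trace x = (\<Sum>i<n. Witt (x ^ 2 ^ i) 0)"

lemma witt_trace_square: "witt_trace (x\<^sup>2) = witt_trace x"
  unfolding witt_trace_def
  using sum_shift[of "\<lambda>i. Witt (x ^ 2 ^ i) 0" n] by (simp add: power_mult)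

lemma witt_trace_frob: "witt_trace (x ^ 2 ^ k) = witt_trace x"
proof (induction k)
  case (Suc k)
  have "x ^ 2 ^ Suc k = (x ^ 2 ^ k)\<^sup>2"
    by (simp add: mult.commute flip: power_mult)
  then show ?case
    using Suc witt_trace_square by simp
qed simp

text \<open>Frobenius permutes the summands cyclically, so it fixes the Witt sum and the second
  component solves \<open>s\<^sup>2 = s\<close>. First components simply add up to the
  trace.\<close>

lemma witt_trace_values:
  obtains s where "witt_trace x = Witt (tr x) s" "s = 0 \<or> s = 1"
proof -
  obtain a s where as: "witt_trace x = Witt a s"
    by (cases "witt_trace x")
  have "a = witt_fst (witt_trace x)"
    using as by simp
  also have "\<dots> = tr x"
    by (simp add: witt_trace_def witt_fst_sum trace_F2_def)
  finally have "a = tr x" .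
  moreover have "witt_frob (witt_trace x) = witt_trace (x\<^sup>2)"
    by (simp add: witt_trace_def witt_frob_sum mult.commute flip: power_mult)
  then have "s\<^sup>2 = s"
    using as witt_trace_square[of x] by simp
  ultimately show ?thesis
    using that as square_eq_self_iff by blast
qed

lemma witt_trace_in_W2_F2: "witt_trace x \<in> W2_F2"
  using witt_trace_values[of x] tr_values[of x] unfolding W2_F2_def by (auto, metis+)

lemma Witt_0_in_W2_F2: "Witt 0 (tr x) \<in> W2_F2"
  using tr_values[of x] unfolding W2_F2_def by auto

lemma W2_F2_add: "u \<in> W2_F2 \<Longrightarrow> v \<in> W2_F2 \<Longrightarrow> u + v \<in> (W2_F2 :: 'a witt2 set)"
  unfolding W2_F2_def by auto

text \<open>The Witt cocycle \<open>x * y\<close> of each conjugate pair is cancelled by adding it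
  once more in the second component. This makes \<open>Q\<close> quadratic with the trace form as
  polar form.\<close>

lemma witt_trace_add: "witt_trace (x + y) = witt_trace x + witt_trace y + Witt 0 (tr (x * y))"
proof -
  have "Witt ((x + y) ^ 2 ^ i) 0
      = Witt (x ^ 2 ^ i) 0 + Witt (y ^ 2 ^ i) 0 + Witt 0 ((x * y) ^ 2 ^ i)" for i
    by (simp add: frob power_mult_distrib)
  then show ?thesis
    by (simp only: witt_trace_def trace_F2_def sum.distrib flip: sum_Witt_0)
qed

text \<open>Pairs the conjugates with indices \<open>i\<close> and \<open>h + i\<close>, which
  passes through the subfield with \<open>2 ^ h\<close> elements.\<close>

lemma sum_half:
  fixes f :: "'a \<Rightarrow> 'b::comm_monoid_add"
  assumes "n = 2 * h"
  shows "(\<Sum>i<n. f (x ^ 2 ^ i)) = (\<Sum>i<h. f (x ^ 2 ^ i) + f ((x ^ 2 ^ h) ^ 2 ^ i))"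
  using assms sum_lessThan_add[of "\<lambda>i. f (x ^ 2 ^ i)" h h]
  by (simp add: mult_2 sum.distrib power_add flip: power_mult)

lemma tr_half:
  assumes "n = 2 * h"
  shows "tr x = trace_F2 h (x + x ^ 2 ^ h)"
  using sum_half[OF assms, of "\<lambda>x. x" x] by (simp add: trace_F2_def frob)

end

section \<open>The additive character \<open>\<psi>\<close> and the quadratic character
  \<open>Q\<close>\<close>

locale witt_character = binary_field n type_a
  for n :: nat and type_a :: "'a::finite_field itself" +
  fixes \<xi> :: "'a witt2 \<Rightarrow> 'k::field_char_0" and \<iota> :: 'k
  assumes root: "primitive_4th_root \<iota>"
    and character: "is_W2_F2_character \<xi>" and \<xi>_1: "\<xi> (Witt 1 0) = \<iota>"
begin

lemma iota_square: "\<iota>\<^sup>2 = -1"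
proof -
  have "(\<iota>\<^sup>2 - 1) * (\<iota>\<^sup>2 + 1) = \<iota> ^ 4 - 1"
    by (simp add: algebra_simps flip: power_add)
  moreover have "\<iota> ^ 4 = 1" "\<iota>\<^sup>2 \<noteq> 1"
    using root by (auto simp: primitive_4th_root_def)
  ultimately show ?thesis
    by (simp add: eq_neg_iff_add_eq_0)
qed

lemma iota_nonzero: "\<iota> \<noteq> 0"
  using iota_square by auto

lemma \<xi>_add: "u \<in> W2_F2 \<Longrightarrow> v \<in> W2_F2 \<Longrightarrow> \<xi> (u + v) = \<xi> u * \<xi> v"
  and \<xi>_nonzero: "u \<in> W2_F2 \<Longrightarrow> \<xi> u \<noteq> 0"
  using character by (auto simp: is_W2_F2_character_def)

lemma \<xi>_0: "\<xi> (Witt 0 0) = 1"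
proof -
  have W: "Witt 0 0 \<in> W2_F2"
    by (auto simp: W2_F2_def)
  then show ?thesis
    using \<xi>_add[OF W W] \<xi>_nonzero[OF W] by simp
qed

lemma \<xi>_0_1: "\<xi> (Witt 0 1) = -1"
proof -
  have W: "Witt 1 0 \<in> W2_F2"
    by (auto simp: W2_F2_def)
  then show ?thesis
    using \<xi>_add[OF W W] iota_square \<xi>_1 by (simp add: power2_eq_square)
qed

abbreviation \<psi> :: "'a \<Rightarrow> 'k" where "\<psi> \<equiv> psi_q n"
abbreviation Q :: "'a \<Rightarrow> 'k" where "Q \<equiv> Q_q n \<xi>"

lemma Q_witt_trace: "Q x = \<xi> (witt_trace x)"
  by (simp add: Q_q_def witt_trace_def)

lemma \<psi>_add: "\<psi> (x + y) = \<psi> x * \<psi> y"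
  using tr_values[of x] tr_values[of y] by (auto simp: psi_q_def tr_add)

lemma \<psi>_0 [simp]: "\<psi> 0 = 1"
  by (simp add: psi_q_def)

lemma \<psi>_square [simp]: "\<psi> x * \<psi> x = 1"
  by (simp add: psi_q_def)

lemma \<psi>_nonzero [simp]: "\<psi> x \<noteq> 0"
  by (simp add: psi_q_def)

lemma \<psi>_eqI: "tr x = tr y \<Longrightarrow> \<psi> x = \<psi> y"
  by (simp add: psi_q_def)

lemma \<xi>_Witt_0: "\<xi> (Witt 0 (tr x)) = \<psi> x"
  using tr_values[of x] \<xi>_0 \<xi>_0_1 by (auto simp: psi_q_def)

lemma sum_shift_UNIV: "(\<Sum>x\<in>UNIV. f (x + c)) = (\<Sum>x\<in>UNIV. f (x :: 'a))"
  by (rule sum.reindex_bij_witness[of _ "\<lambda>x. x + c" "\<lambda>x. x + c"]) (auto simp: add.assoc)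

lemma sum_\<psi>: "(\<Sum>x\<in>UNIV. \<psi> (a * x)) = (if a = 0 then 2 ^ n else 0)"
proof (cases "a = 0")
  case False
  then obtain c where "tr (a * c) \<noteq> 0"
    using tr_pairing_nondegenerate by blast
  then have c: "\<psi> (a * c) = -1"
    by (simp add: psi_q_def)
  have "(\<Sum>x\<in>UNIV. \<psi> (a * x)) = (\<Sum>x\<in>UNIV. \<psi> (a * (x + c)))"
    using sum_shift_UNIV[of "\<lambda>x. \<psi> (a * x)"] by simp
  also have "\<dots> = - (\<Sum>x\<in>UNIV. \<psi> (a * x))"
    by (simp add: distrib_left \<psi>_add c sum_negf)
  finally show ?thesis
    using False by simp
qed (simp add: card_UNIV)

text \<open>Orthogonality detects \<open>f x = y\<close>; after moving \<open>f\<close> across the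
  trace form, the sum over \<open>x\<close> vanishes unless \<open>g z = 0\<close>. Later it serves
  both as Poisson summation and as a solvability criterion: if \<open>\<psi> (z * y) = 1\<close> on
  the kernel of \<open>g\<close>, the fiber is nonempty.\<close>

lemma card_fiber:
  assumes adjoint: "\<And>x z. tr (z * f x) = tr (g z * x)"
  shows "of_nat (card {x. f x = y}) = (\<Sum>z | g z = 0. \<psi> (z * y))"
proof -
  have "2 ^ n * of_nat (card {x. f x = y}) = (\<Sum>x\<in>UNIV. if f x = y then 2 ^ n else (0::'k))"
    by (simp add: sum.If_cases)
  also have "\<dots> = (\<Sum>x\<in>UNIV. \<Sum>z\<in>UNIV. \<psi> ((f x + y) * z))"
    by (simp add: sum_\<psi>)
  also have "\<dots> = (\<Sum>z\<in>UNIV. \<Sum>x\<in>UNIV. \<psi> (z * y) * \<psi> (g z * x))"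
  proof -
    have "\<psi> ((f x + y) * z) = \<psi> (z * y) * \<psi> (g z * x)" for x z
      using \<psi>_eqI[OF adjoint, of z x] by (simp add: distrib_left \<psi>_add mult.commute)
    then show ?thesis
      by (subst sum.swap) simp
  qed
  also have "\<dots> = (\<Sum>z\<in>UNIV. if g z = 0 then 2 ^ n * \<psi> (z * y) else 0)"
    unfolding sum_distrib_left[symmetric] sum_\<psi> by (intro sum.cong) auto
  also have "\<dots> = 2 ^ n * (\<Sum>z | g z = 0. \<psi> (z * y))"
    by (simp add: sum.If_cases sum_distrib_left)
  finally show ?thesis
    by simp
qed

lemma Q_add: "Q (x + y) = Q x * Q y * \<psi> (x * y)"
  by (simp add: Q_witt_trace witt_trace_add \<xi>_add W2_F2_add witt_trace_in_W2_F2
      Witt_0_in_W2_F2 \<xi>_Witt_0)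

lemma Q_nonzero [simp]: "Q x \<noteq> 0"
  by (simp add: Q_witt_trace \<xi>_nonzero witt_trace_in_W2_F2)

lemma Q_0 [simp]: "Q 0 = 1"
  using Q_add[of 0 0] by simp

lemma Q_frob: "Q (x ^ 2 ^ k) = Q x"
  by (simp add: Q_witt_trace witt_trace_frob)

lemma Q_values: "Q x \<in> {1, -1, \<iota>, -\<iota>}"
proof -
  have "\<xi> (Witt 1 1) = -\<iota>"
    using \<xi>_add[of "Witt 1 0" "Witt 0 1"] \<xi>_0_1 \<xi>_1 by (auto simp: W2_F2_def)
  then show ?thesis
    using witt_trace_in_W2_F2[of x] \<xi>_0 \<xi>_0_1 \<xi>_1 by (auto simp: Q_witt_trace W2_F2_def)
qed

definition G :: "'a \<Rightarrow> 'k" where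
  "G u = (\<Sum>y\<in>UNIV. Q y * \<psi> (u * y))"

text \<open>Completing the square: translating the summation variable by \<open>u\<close> produces
  the linear twist.\<close>

lemma G_shift: "G u * Q u = G 0"
proof -
  have "G 0 = (\<Sum>y\<in>UNIV. Q (y + u))"
    using sum_shift_UNIV[of Q u] by (simp add: G_def)
  also have "\<dots> = G u * Q u"
    by (simp add: G_def Q_add sum_distrib_left mult_ac)
  finally show ?thesis
    by simp
qed

section \<open>The Gauss sum in even degree\<close>

context
  fixes h :: nat
  assumes n_even: "n = 2 * h"
begin

lemma h_pos: "h > 0"
  using n_pos n_even by simp

lemma frob_h_twice [simp]: "(x ^ 2 ^ h) ^ 2 ^ h = (x :: 'a)"
  using power_card[of x] n_even by (simp add: mult_2 power_add flip: power_mult)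

lemma relative_trace_self_adjoint: "tr (z * (x ^ 2 ^ h + x)) = tr ((z ^ 2 ^ h + z) * x)"
proof -
  have "tr (z * x ^ 2 ^ h) = tr (z ^ 2 ^ h * x)"
    by (rule tr_sqrt_cong[where k = h]) (simp add: power_mult_distrib)
  then show ?thesis
    by (simp add: distrib_left distrib_right tr_add)
qed

text \<open>By \<open>card_fiber\<close> the number of solutions is a sum of \<open>\<psi>\<close>
  over the subfield with \<open>2 ^ h\<close> elements. There the conjugates cancel in pairs, so
  every term is 1 and the count is positive.\<close>

lemma relative_trace_surj: "\<exists>c. c ^ 2 ^ h + c = (1 :: 'a)"
proof -
  have one: "\<psi> z = 1" if "z ^ 2 ^ h = z" for z
    using tr_half[OF n_even, of z] that by (simp add: psi_q_def trace_F2_def power_0_left)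
  have "of_nat (card {c. c ^ 2 ^ h + c = (1 :: 'a)})
      = (\<Sum>z | z ^ 2 ^ h + z = (0 :: 'a). \<psi> (z * 1))"
    by (rule card_fiber) (rule relative_trace_self_adjoint)
  also have "\<dots> = of_nat (card {z :: 'a. z ^ 2 ^ h = z})"
    using one by simp
  also have "\<dots> \<noteq> 0"
    using card_subfield[of h 2] h_pos n_even by (simp add: mult.commute)
  finally show ?thesis
    by (metis (mono_tags, lifting) Collect_empty_eq card.empty of_nat_0)
qed

text \<open>Paired conjugates of \<open>c\<close> differ by 1, so each pair has Witt sum
  \<open>Witt 1 0\<close> plus a telescoping term. The \<open>h\<close> copies of
  \<open>Witt 1 0\<close> give \<open>\<iota> ^ h\<close>, and the telescoped
  \<open>Witt 0 1\<close> gives the sign.\<close>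

lemma Q_relative_trace_one:
  assumes c: "c ^ 2 ^ h + c = (1 :: 'a)"
  shows "Q c = - (\<iota> ^ h)"
proof -
  have ch: "c ^ 2 ^ h = c + 1"
    using c by (metis add.commute add_self_left)
  define a where "a i = c ^ 2 ^ i" for i
  have "witt_trace c = (\<Sum>i<h. Witt (a i) 0 + Witt ((c + 1) ^ 2 ^ i) 0)"
    using sum_half[OF n_even, of "\<lambda>x. Witt x 0" c] ch by (simp add: witt_trace_def a_def)
  also have "\<dots> = (\<Sum>i<h. Witt 1 0 + Witt 0 (a (Suc i) + a i))"
  proof (rule sum.cong)
    fix i
    have "a (Suc i) = a i * a i"
      by (simp add: a_def power_mult power2_eq_square power_mult_distrib)
    then show "Witt (a i) 0 + Witt ((c + 1) ^ 2 ^ i) 0 = Witt 1 0 + Witt 0 (a (Suc i) + a i)"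
      by (simp add: frob a_def algebra_simps)
  qed simp
  also have "\<dots> = (\<Sum>i<h. Witt 1 0) + Witt 0 (\<Sum>i<h. a (Suc i) + a i)"
    by (simp only: sum.distrib sum_Witt_0)
  \<comment> \<open>In characteristic 2 this is the telescoping sum \<open>a h - a 0\<close>, that
    is, the relative trace of \<open>c\<close>.\<close>
  also have "(\<Sum>i<h. a (Suc i) + a i) = 1"
    using sum_lessThan_telescope[of a h] c by (simp add: a_def)
  finally have eq: "witt_trace c = (\<Sum>i<h. Witt 1 0) + Witt 0 1" .
  have "(\<Sum>i<k. Witt 1 (0 :: 'a)) \<in> W2_F2 \<and> \<xi> (\<Sum>i<k. Witt 1 0) = \<iota> ^ k" for k
  proof (induction k)
    case 0
    show ?case
      using \<xi>_0 by (auto simp: zero_witt2_def W2_F2_def)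
  next
    case (Suc k)
    moreover have "Witt 1 (0 :: 'a) \<in> W2_F2"
      by (auto simp: W2_F2_def)
    ultimately show ?case
      by (simp add: \<xi>_add W2_F2_add \<xi>_1 mult.commute)
  qed
  moreover have "Witt 0 (1 :: 'a) \<in> W2_F2"
    by (auto simp: W2_F2_def)
  ultimately show ?thesis
    using eq by (simp add: Q_witt_trace \<xi>_add \<xi>_0_1)
qed

text \<open>For such \<open>w\<close> both halves of the Witt sum agree. Doubling a Witt vector
  leaves only the square of its first component, here the trace of \<open>w\<close> from the
  subfield, which equals \<open>tr (c * w)\<close> because \<open>c\<close> has relative trace
  1.\<close>

lemma Q_subfield:
  assumes c: "c ^ 2 ^ h + c = (1 :: 'a)" and w: "w ^ 2 ^ h = w"
  shows "Q w = \<psi> (c * w)"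
proof -
  define S where "S = (\<Sum>i<h. Witt (w ^ 2 ^ i) 0)"
  have "witt_fst S = trace_F2 h w"
    by (simp add: S_def witt_fst_sum trace_F2_def)
  moreover have "S + S = Witt 0 ((witt_fst S)\<^sup>2)"
    by (cases S) (simp add: power2_eq_square)
  moreover have "witt_trace w = S + S"
    using sum_half[OF n_even, of "\<lambda>x. Witt x 0" w] w
    by (simp only: witt_trace_def S_def sum.distrib)
  moreover have "tr (c * w) = trace_F2 h w"
  proof -
    have "c * w + (c * w) ^ 2 ^ h = (c ^ 2 ^ h + c) * w"
      using w by (simp add: power_mult_distrib algebra_simps)
    then show ?thesis
      using tr_half[OF n_even, of "c * w"] c by simp
  qed
  ultimately have "witt_trace w = Witt 0 (tr (c * w))"
    using tr_values[of "c * w"] square_eq_self_iff[of "tr (c * w)"] by simp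
  then show ?thesis
    by (simp add: Q_witt_trace \<xi>_Witt_0)
qed

text \<open>
  Twisting by \<open>c\<close> makes \<open>Q\<close> trivial on the subfield with \<open>2 ^ h\<close> elements, which is a maximal
  isotropic subspace for the trace form. This fixes the sign of the Gauss sum, which its square
  does not determine.
\<close>
lemma gauss_sum: "G 0 = - (2 ^ h * \<iota> ^ h)"
proof -
  obtain c :: 'a where c: "c ^ 2 ^ h + c = 1"
    using relative_trace_surj by blast
  define K where "K = {w :: 'a. w ^ 2 ^ h = w}"
  define g where "g y = Q y * \<psi> (c * y)" for y
  have shift: "G c = (\<Sum>y\<in>UNIV. g y * \<psi> (w * y))" if "w \<in> K" for w
  proof -
    have gw: "g w = 1"
      using Q_subfield[OF c, of w] that by (simp add: g_def K_def)
    have "G c = (\<Sum>y\<in>UNIV. g (y + w))"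
      using sum_shift_UNIV[of g w] by (simp add: g_def G_def)
    also have "\<dots> = (\<Sum>y\<in>UNIV. g y * \<psi> (w * y) * g w)"
      by (simp add: g_def Q_add \<psi>_add distrib_left mult_ac)
    finally show ?thesis
      by (simp add: gw)
  qed
  \<comment> \<open>Averaging \<open>shift\<close> over \<open>K\<close> turns the sums of
    \<open>\<psi>\<close> into fiber counts of the relative trace. Only values of \<open>g\<close>
    on its image remain; that image lies in \<open>K\<close>, where \<open>g\<close> is 1.\<close>
  have "of_nat (card K) * G c = (\<Sum>w\<in>K. \<Sum>y\<in>UNIV. g y * \<psi> (w * y))"
    by (subst sum.cong[OF refl shift[symmetric]]) simp_all
  also have "\<dots> = (\<Sum>y\<in>UNIV. g y * (\<Sum>w | w ^ 2 ^ h + w = 0. \<psi> (w * y)))"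
    by (subst sum.swap) (simp add: sum_distrib_left K_def)
  also have "\<dots> = (\<Sum>y\<in>UNIV. g y * of_nat (card {x. x ^ 2 ^ h + x = y}))"
    by (subst card_fiber[OF relative_trace_self_adjoint]) simp
  also have "\<dots> = (\<Sum>x\<in>UNIV. g (x ^ 2 ^ h + x))"
    by (rule sum_over_fibers)
  also have "\<dots> = 2 ^ n"
  proof -
    have "g (x ^ 2 ^ h + x) = 1" for x
      using Q_subfield[OF c, of "x ^ 2 ^ h + x"] by (simp add: g_def frob add.commute)
    then show ?thesis
      by (simp add: card_UNIV)
  qed
  also have "card K = 2 ^ h"
    using card_subfield[of h 2] h_pos n_even by (simp add: K_def mult.commute)
  finally have "G c = 2 ^ h"
    using n_even by (simp add: mult_2 power_add)
  then show ?thesis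
    using G_shift[of c] Q_relative_trace_one[OF c] by simp
qed

end

end

section \<open>Additive polynomials\<close>

lemma sum_pairs_less:
  fixes f :: "nat \<Rightarrow> nat \<Rightarrow> 'b::comm_monoid_add"
  shows "(\<Sum>(i, j)\<in>{(i, j). i < j \<and> j \<le> e}. f i j) = (\<Sum>j\<le>e. \<Sum>i<j. f i j)"
  by (subst sum.Sigma, simp, simp)
     (rule sum.reindex_bij_witness[of _ prod.swap prod.swap], auto)

text \<open>The coefficients of \<open>R\<close> collect index pairs by their difference; this
  returns to summation over pairs.\<close>

lemma sum_pairs_difference:
  fixes f :: "nat \<Rightarrow> nat \<Rightarrow> 'b::comm_monoid_add"
  shows "(\<Sum>i=1..e. \<Sum>j\<le>e - i. f j (j + i)) = (\<Sum>j\<le>e. \<Sum>i<j. f i j)"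
  by (subst sum.Sigma, simp, simp, subst sum.Sigma, simp, simp)
     (rule sum.reindex_bij_witness[of _ "\<lambda>(j, i). (j - i, i)" "\<lambda>(i, j). (j + i, j)"], auto)

lemma sum_square_pairs:
  fixes x :: "nat \<Rightarrow> 'b::comm_semiring_0"
  shows "(\<Sum>j\<le>e. \<Sum>i<j. (x i * c) * (x j * c)) = (\<Sum>j\<le>e. \<Sum>i<j. x i * x j) * c * c"
  by (simp add: sum_distrib_left mult_ac)

lemma poly_F_poly: "poly (F_poly p e b) x = (\<Sum>i\<le>e. b i * x ^ p ^ i)"
  by (simp add: F_poly_def poly_sum poly_monom)

lemma map_F_poly: "map_poly to_ac (F_poly p e b) = F_poly p e (to_ac \<circ> b)"
  by (rule poly_eqI)
     (auto simp: F_poly_def coeff_map_poly coeff_sum to_ac_sum intro!: sum.cong)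

text \<open>Raising to the power \<open>2 ^ (s * e)\<close> clears all roots and gives an additive
  polynomial. Its linear coefficient \<open>b e\<close> makes it separable, and its leading
  coefficient, a power of \<open>b 0\<close>, fixes the degree.\<close>

lemma card_F_star_zeros:
  fixes b :: "nat \<Rightarrow> 'f::alg_closed_field"
  assumes char: "CHAR('f) = 2" and s: "s > 0" and b: "b 0 \<noteq> 0" "b e \<noteq> 0"
  shows "card {x. F_star (2 ^ s) e b x = 0} = 2 ^ (s * e)"
proof -
  define P where "P = (\<Sum>i\<le>e. monom (b i ^ 2 ^ (s * (e - i))) (2 ^ (s * (e - i))))"
  have root: "frob_root (2 ^ s) i y ^ 2 ^ (s * i) = y" for i and y :: 'f
    using frob_root_power[of "2 ^ s" i y] frob_surj_alg_closed[where ?'f = 'f, of "s * i"]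
    by (simp flip: power_mult)
  have "F_star (2 ^ s) e b x ^ 2 ^ (s * e) = poly P x" for x
  proof -
    have "frob_root (2 ^ s) i (b i * x) ^ 2 ^ (s * e) = (b i * x) ^ 2 ^ (s * (e - i))"
      if "i \<le> e" for i
    proof -
      have "s * e = s * i + s * (e - i)"
        using that by (simp flip: distrib_left)
      then have "frob_root (2 ^ s) i (b i * x) ^ 2 ^ (s * e)
          = (frob_root (2 ^ s) i (b i * x) ^ 2 ^ (s * i)) ^ 2 ^ (s * (e - i))"
        by (simp add: power_add flip: power_mult)
      then show ?thesis
        by (simp add: root)
    qed
    then show ?thesis
      by (simp add: F_star_def frob_sum[OF char] P_def poly_sum poly_monom power_mult_distrib)
  qed
  then have "{x. F_star (2 ^ s) e b x = 0} = {x. poly P x = 0}"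
    by (metis (no_types, lifting) power_eq_0_iff zero_less_numeral zero_less_power)
  moreover have "pderiv P = [:b e:]"
  proof -
    have two: "(2 :: 'f) = 0"
      using add_self_CHAR_2[OF char, of 1] by simp
    have "pderiv (monom (b i ^ 2 ^ (s * (e - i))) (2 ^ (s * (e - i))))
        = (if i = e then [:b e:] else 0)" if "i \<le> e" for i
      using that s two by (auto simp: pderiv_monom monom_0 power_0_left)
    moreover have "pderiv (sum f A) = (\<Sum>i\<in>A. pderiv (f i))" for f :: "nat \<Rightarrow> 'f poly" and A
      by (induction A rule: infinite_finite_induct) (simp_all add: pderiv_add)
    ultimately show ?thesis
      by (simp add: P_def)
  qed
  moreover have "degree P = 2 ^ (s * e)"
  proof (rule antisym)
    show "degree P \<le> 2 ^ (s * e)"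
      unfolding P_def
      by (intro degree_sum_le) (auto intro: order.trans[OF degree_monom_le])
    have "coeff P (2 ^ (s * e))
        = (\<Sum>i\<le>e. if i = 0 then b i ^ 2 ^ (s * (e - i)) else 0)"
      unfolding P_def coeff_sum using s by (intro sum.cong) auto
    also have "\<dots> \<noteq> 0"
      using b by simp
    finally show "2 ^ (s * e) \<le> degree P"
      by (rule le_degree)
  qed
  ultimately show ?thesis
    using card_roots_pderiv_const[of P "b e"] b by simp
qed

context witt_character
begin

lemma Q_sum:
  fixes u :: "nat \<Rightarrow> 'a"
  shows "Q (\<Sum>i\<le>e. u i) = (\<Prod>i\<le>e. Q (u i)) * \<psi> (\<Sum>j\<le>e. \<Sum>i<j. u i * u j)"
  by (induction e)
     (simp_all add: Q_add \<psi>_add sum_distrib_right lessThan_Suc_atMost)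

end

section \<open>The polynomial \<open>F\<close>, its adjoint \<open>Fs\<close> and the kernel
  \<open>V\<close>\<close>

locale additive_polynomial = witt_character n type_a \<xi> \<iota>
  for n :: nat and type_a :: "'a::finite_field itself"
    and \<xi> :: "'a witt2 \<Rightarrow> 'k::field_char_0" and \<iota> :: 'k +
  fixes s m e :: nat and b :: "nat \<Rightarrow> 'a"
  assumes s_pos: "s > 0" and n_eq: "n = s * m"
    and b_nonzero: "b 0 * b e \<noteq> 0"
    and F_star_1: "F_star (2 ^ s) e (to_ac \<circ> b) 1 = 0"
    and W_rational: "W_star (2 ^ s) e b \<subseteq> range to_ac"
    and FF_rational:
      "{x. F_star (2 ^ s) e (to_ac \<circ> b) (poly (map_poly to_ac (F_poly (2 ^ s) e b)) x) = 0}
        \<subseteq> range to_ac"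
begin

definition F :: "'a \<Rightarrow> 'a" where "F x = (\<Sum>i\<le>e. b i * x ^ 2 ^ (s * i))"

abbreviation Fs :: "'a \<Rightarrow> 'a" where "Fs \<equiv> F_star (2 ^ s) e b"
abbreviation R :: "'a poly" where "R \<equiv> R_poly (2 ^ s) e b"
abbreviation \<gamma> :: 'a where "\<gamma> \<equiv> gamma_F (2 ^ s) e b"
abbreviation \<alpha> :: "'a \<Rightarrow> 'a" where "\<alpha> \<equiv> alpha_F (2 ^ s) e b"
abbreviation root :: "nat \<Rightarrow> 'a \<Rightarrow> 'a" where "root \<equiv> frob_root (2 ^ s)"

definition V :: "'a set" where "V = {v. Fs v = 0}"

lemma to_ac_F_star: "to_ac (Fs x) = F_star (2 ^ s) e (to_ac \<circ> b) (to_ac x)"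
  by (simp add: F_star_def to_ac_sum to_ac_frob_root)

lemma in_W_star_iff: "to_ac v \<in> W_star (2 ^ s) e b \<longleftrightarrow> v \<in> V"
  by (simp add: W_star_def V_def flip: to_ac_F_star)

text \<open>Rationality of \<open>W_star\<close> identifies it with \<open>V\<close>, so the count
  over the closure applies.\<close>

lemma card_V: "card V = 2 ^ (s * e)"
proof -
  have "W_star (2 ^ s) e b = to_ac ` V"
    using W_rational in_W_star_iff by blast
  then have "card V = card (W_star (2 ^ s) e b)"
    by (simp add: card_image inj_on_subset[OF inj_to_ac])
  also have "\<dots> = 2 ^ (s * e)"
    unfolding W_star_def
    using b_nonzero by (intro card_F_star_zeros CHAR_2_closure s_pos) auto
  finally show ?thesis .
qed

lemma F_add: "F (x + y) = F x + F y"
  by (simp add: F_def frob distrib_left sum.distrib)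

lemma F_star_add: "Fs (x + y) = Fs x + Fs y"
proof -
  have "root i (x + y) = root i x + root i y" for i x y
    by (rule frob_root_eqI)
       (use frob_inj[OF CHAR_2, of "s * i"] in \<open>simp_all add: frob flip: power_mult\<close>)
  then show ?thesis
    by (simp add: F_star_def distrib_left sum.distrib)
qed

lemma V_add: "v \<in> V \<Longrightarrow> w \<in> V \<Longrightarrow> v + w \<in> V"
  by (simp add: V_def F_star_add)

lemma one_in_V: "1 \<in> V"
  using F_star_1 by (simp add: V_def flip: to_ac_F_star to_ac_1)

text \<open>The trace is Frobenius invariant, so the root of order \<open>2 ^ (s * i)\<close> may be
  taken in the \<open>i\<close>-th term.\<close>

lemma F_adjoint: "tr (z * F x) = tr (Fs z * x)"
proof -
  have "tr (z * (b i * x ^ 2 ^ (s * i))) = tr (root i (b i * z) * x)" for i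
    by (rule tr_sqrt_cong[symmetric, of _ "s * i"]) (simp add: power_mult_distrib)
  then show ?thesis
    by (simp add: F_def F_star_def sum_distrib_left sum_distrib_right tr_sum)
qed

lemma F_star_adjoint: "tr (z * Fs x) = tr (F z * x)"
  using F_adjoint[of x z] by (simp add: mult.commute)

text \<open>Over the closure \<open>F x = w\<close> is solvable, and any solution is killed by
  \<open>Fs\<close> after \<open>F\<close>; \<open>FF_rational\<close> then puts it in the finite
  field.\<close>

lemma V_subset_range_F:
  assumes "w \<in> V"
  shows "\<exists>x. F x = w"
proof -
  define P where "P = F_poly (2 ^ s) e (to_ac \<circ> b) - [:to_ac w:]"
  have "coeff (F_poly (2 ^ s) e (to_ac \<circ> b)) (2 ^ (s * e))
      = (\<Sum>i\<le>e. if i = e then to_ac (b i) else 0)"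
    unfolding F_poly_def coeff_sum using s_pos by (intro sum.cong) (auto simp flip: power_mult)
  then have "coeff P (2 ^ (s * e)) \<noteq> 0"
    using b_nonzero by (simp add: P_def coeff_pCons split: nat.splits)
  then have "degree P > 0"
    using le_degree[of P "2 ^ (s * e)"] by (metis gr0I le_zero_eq power_not_zero zero_neq_numeral)
  then obtain x where x: "poly P x = 0"
    using alg_closed_imp_poly_has_root by blast
  then have Fx: "poly (F_poly (2 ^ s) e (to_ac \<circ> b)) x = to_ac w"
    by (simp add: P_def)
  then have "F_star (2 ^ s) e (to_ac \<circ> b) (poly (map_poly to_ac (F_poly (2 ^ s) e b)) x) = 0"
    using assms by (simp add: map_F_poly V_def flip: to_ac_F_star)
  then obtain y where y: "x = to_ac y"
    using FF_rational by blast
  have "to_ac (F y) = to_ac w"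
    unfolding Fx[symmetric] y by (simp add: F_def poly_F_poly to_ac_sum power_mult)
  then show ?thesis
    by auto
qed

lemma V_isotropic:
  assumes "v \<in> V" "w \<in> V"
  shows "\<psi> (v * w) = 1"
proof -
  obtain x where "w = F x"
    using V_subset_range_F[OF assms(2)] by blast
  then show ?thesis
    using assms(1) F_adjoint[of v x] by (simp add: V_def psi_q_def)
qed

text \<open>Isotropy applied to \<open>1 \<in> V\<close> gives \<open>tr 1 = 0\<close>, while
  \<open>tr 1\<close> is \<open>n\<close> reduced modulo 2.\<close>

lemma n_even: "even n"
proof -
  have "tr 1 = 0"
    using V_isotropic[OF one_in_V one_in_V] by (simp add: psi_q_def split: if_splits)
  then have "of_nat n = (0 :: 'a)"
    by (simp add: trace_F2_def)
  then show ?thesis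
    by (simp add: of_nat_eq_0_iff_char_dvd CHAR_2)
qed

text \<open>Raising the term with indices \<open>i\<close>, \<open>j\<close> to the power
  \<open>2 ^ (s * j)\<close> keeps its trace and removes the root in \<open>R_coeff\<close>, leaving
  a product of two terms of \<open>F x\<close>.\<close>

lemma tr_R: "tr (x * poly R x)
    = tr (\<Sum>j\<le>e. \<Sum>i<j. (b i * x ^ 2 ^ (s * i)) * (b j * x ^ 2 ^ (s * j)))"
proof -
  have summand: "tr (root j (b j * b (j + i)) * x ^ 2 ^ (s * i) * x)
      = tr ((b j * x ^ 2 ^ (s * j)) * (b (j + i) * x ^ 2 ^ (s * (j + i))))" for i j
  proof (rule tr_sqrt_cong)
    have "(x ^ 2 ^ (s * i)) ^ 2 ^ (s * j) = x ^ 2 ^ (s * (j + i))"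
      by (simp add: distrib_left power_add mult.commute flip: power_mult)
    then show "(root j (b j * b (j + i)) * x ^ 2 ^ (s * i) * x) ^ 2 ^ (s * j)
        = (b j * x ^ 2 ^ (s * j)) * (b (j + i) * x ^ 2 ^ (s * (j + i)))"
      using frob_root_power_finite[of s j "b j * b (j + i)"]
      by (simp add: power_mult_distrib mult_ac)
  qed
  have "x * poly R x
      = (\<Sum>i=1..e. \<Sum>j\<le>e - i. root j (b j * b (j + i)) * x ^ 2 ^ (s * i) * x)"
    by (simp add: R_poly_def R_coeff_def poly_sum poly_monom sum_distrib_left sum_distrib_right
        mult_ac flip: power_mult)
  then have "tr (x * poly R x) = (\<Sum>i=1..e. \<Sum>j\<le>e - i.
      tr ((b j * x ^ 2 ^ (s * j)) * (b (j + i) * x ^ 2 ^ (s * (j + i)))))"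
    by (simp only: tr_sum summand)
  then show ?thesis
    using sum_pairs_difference[where f = "\<lambda>i j. tr ((b i * x ^ 2 ^ (s * i)) * (b j * x ^ 2 ^ (s * j)))"]
    by (simp add: tr_sum)
qed

text \<open>The terms of \<open>F x\<close> are Frobenius images of \<open>c i * x\<close>, so both
  families have the same \<open>Q\<close> values. Their product is found by expanding
  \<open>Q\<close> of the vanishing sum of the \<open>c i * x\<close>, whose cross terms give
  \<open>\<gamma>\<close>.\<close>

lemma Q_F: "Q (F x) = \<psi> (x * poly R x + \<gamma> * x * x)"
proof -
  define c where "c i = root i (b i)" for i
  have "Q (b i * x ^ 2 ^ (s * i)) = Q (c i * x)" for i
    using Q_frob[of "c i * x" "s * i"] by (simp add: power_mult_distrib c_def)
  then have QF: "Q (F x) = (\<Prod>i\<le>e. Q (c i * x)) * \<psi> (x * poly R x)"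
    using \<psi>_eqI[OF tr_R, of x] by (simp add: F_def Q_sum)
  have "(\<Sum>i\<le>e. c i * x) = Fs 1 * x"
    by (simp add: F_star_def c_def sum_distrib_right)
  also have "\<dots> = 0"
    using one_in_V by (simp add: V_def)
  finally have sum_0: "(\<Sum>i\<le>e. c i * x) = 0" .
  have "(\<Prod>i\<le>e. Q (c i * x)) * \<psi> (\<Sum>j\<le>e. \<Sum>i<j. (c i * x) * (c j * x)) = 1"
    by (simp only: Q_sum[symmetric] sum_0 Q_0)
  also have "(\<Sum>j\<le>e. \<Sum>i<j. (c i * x) * (c j * x)) = \<gamma> * x * x"
    by (simp add: sum_square_pairs gamma_F_def c_def sum_pairs_less)
  finally have "(\<Prod>i\<le>e. Q (c i * x)) = \<psi> (\<gamma> * x * x)"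
    by (metis \<psi>_nonzero \<psi>_square mult_right_cancel)
  then show ?thesis
    using QF by (simp add: \<psi>_add mult.commute)
qed

section \<open>The character sum \<open>S\<close> and the point count\<close>

definition S :: "'a \<Rightarrow> 'k" where
  "S a = (\<Sum>x\<in>UNIV. \<psi> (x * (poly R x + a * x)))"

lemma S_shifted: "S (\<gamma> + d\<^sup>2) = (\<Sum>x\<in>UNIV. Q (F x) * \<psi> (d * x))"
proof -
  have "\<psi> (x * (poly R x + (\<gamma> + d\<^sup>2) * x)) = Q (F x) * \<psi> (d * x)" for x
  proof -
    have "x * (poly R x + (\<gamma> + d\<^sup>2) * x) = (x * poly R x + \<gamma> * x * x) + (d * x)\<^sup>2"
      by (simp add: algebra_simps power2_eq_square)
    moreover have "\<psi> ((d * x)\<^sup>2) = \<psi> (d * x)"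
      by (rule \<psi>_eqI) (rule tr_square)
    ultimately show ?thesis
      by (simp only: \<psi>_add Q_F)
  qed
  then show ?thesis
    by (simp add: S_def)
qed

lemma S_\<alpha>_eq_sum: "S (\<alpha> t) = (\<Sum>w\<in>V. G (t + w))"
proof -
  have "S (\<alpha> t) = (\<Sum>x\<in>UNIV. Q (F x) * \<psi> (t * F x))"
    unfolding alpha_F_def S_shifted using \<psi>_eqI[OF F_adjoint, of t] by simp
  also have "\<dots> = (\<Sum>y\<in>UNIV. (Q y * \<psi> (t * y)) * of_nat (card {x. F x = y}))"
    by (rule sum_over_fibers[symmetric])
  also have "\<dots> = (\<Sum>y\<in>UNIV. (Q y * \<psi> (t * y)) * (\<Sum>w\<in>V. \<psi> (w * y)))"
    by (subst card_fiber[OF F_adjoint]) (simp add: V_def)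
  also have "\<dots> = (\<Sum>w\<in>V. G (t + w))"
    by (simp add: sum_distrib_left G_def \<psi>_add distrib_right mult.assoc)
       (rule sum.swap)
  finally show ?thesis .
qed

definition \<chi> :: "'a \<Rightarrow> 'a \<Rightarrow> 'k" where
  "\<chi> t w = \<psi> (t * w) / Q w"

lemma S_\<alpha>: "S (\<alpha> t) = G 0 / Q t * (\<Sum>w\<in>V. \<chi> t w)"
proof -
  have "G (t + w) = G 0 / Q t * \<chi> t w" for w
  proof -
    have "1 / \<psi> (t * w) = \<psi> (t * w)"
      by (simp add: psi_q_def)
    then have "G 0 / Q t * \<chi> t w = G 0 / Q (t + w)"
      by (simp add: \<chi>_def Q_add psi_q_def)
    then show ?thesis
      using G_shift[of "t + w"] by (metis Q_nonzero nonzero_eq_divide_eq)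
  qed
  then show ?thesis
    by (simp add: S_\<alpha>_eq_sum sum_distrib_left)
qed

text \<open>The cross factor \<open>\<psi> (v * w)\<close> from \<open>Q_add\<close> is 1 by
  isotropy.\<close>

lemma \<chi>_add: "v \<in> V \<Longrightarrow> w \<in> V \<Longrightarrow> \<chi> t (v + w) = \<chi> t v * \<chi> t w"
  by (simp add: \<chi>_def Q_add V_isotropic \<psi>_add distrib_left)

abbreviation SF :: "'a set" where "SF \<equiv> S_F (2 ^ s) n e b \<xi>"

lemma S_F_iff: "t \<in> SF \<longleftrightarrow> (\<forall>v\<in>V. \<chi> t v = 1)"
  by (auto simp: S_F_def in_W_star_iff \<chi>_def)

lemma sum_\<chi>: "(\<Sum>w\<in>V. \<chi> t w) = (if t \<in> SF then 2 ^ (s * e) else 0)"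
proof (cases "t \<in> SF")
  case False
  then obtain v where v: "v \<in> V" "\<chi> t v \<noteq> 1"
    by (auto simp: S_F_iff)
  have "(\<Sum>w\<in>V. \<chi> t w) = (\<Sum>w\<in>V. \<chi> t (w + v))"
    by (rule sum.reindex_bij_witness[of _ "\<lambda>w. w + v" "\<lambda>w. w + v"])
       (use v V_add in \<open>auto simp: add.assoc\<close>)
  also have "\<dots> = (\<Sum>w\<in>V. \<chi> t w) * \<chi> t v"
    by (simp add: \<chi>_add v sum_distrib_right)
  finally show ?thesis
    using v False by (metis mult_cancel_left1)
qed (simp add: S_F_iff card_V)

text \<open>Translation by a zero \<open>k\<close> of \<open>F\<close> multiplies \<open>S a\<close>
  by \<open>\<psi> (k * d)\<close>, so a nonzero sum makes \<open>d\<close> orthogonal to the kernel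
  of \<open>F\<close>. Then \<open>card_fiber\<close>, with \<open>F\<close> as the adjoint of
  \<open>Fs\<close>, yields a preimage of \<open>d\<close>.\<close>

lemma S_nonzero_imp_range:
  assumes "S a \<noteq> 0"
  shows "a \<in> range \<alpha>"
proof -
  obtain d where d: "d\<^sup>2 = a + \<gamma>"
    using frob_surj_finite[OF CHAR_2, of 1] unfolding surj_def by (metis power_one_right)
  have a: "a = \<gamma> + d\<^sup>2"
    unfolding d by (simp add: add.commute)
  have one: "\<psi> (k * d) = 1" if k: "F k = 0" for k
  proof -
    have "S a = (\<Sum>x\<in>UNIV. Q (F (x + k)) * \<psi> (d * (x + k)))"
      unfolding a S_shifted by (rule sum_shift_UNIV[symmetric])
    also have "\<dots> = S a * \<psi> (k * d)"
      unfolding a S_shifted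
      by (simp add: F_add k \<psi>_add distrib_left sum_distrib_left mult_ac)
    finally show ?thesis
      using assms by simp
  qed
  have "of_nat (card {t. Fs t = d}) = (\<Sum>k | F k = 0. \<psi> (k * d))"
    by (rule card_fiber) (rule F_star_adjoint)
  also have "\<dots> = of_nat (card {k. F k = 0})"
    using one by simp
  also have "\<dots> \<noteq> 0"
  proof -
    have "F 0 = 0"
      by (simp add: F_def power_0_left)
    then show ?thesis
      by (auto simp: card_eq_0_iff)
  qed
  finally obtain t where "Fs t = d"
    by (metis (mono_tags, lifting) Collect_empty_eq card.empty of_nat_0)
  then have "a = \<alpha> t"
    using a by (simp add: alpha_F_def)
  then show ?thesis
    by blast
qed

text \<open>Each fiber over \<open>x\<close> is a sum of \<open>\<psi>\<close> over the subfield
  \<open>K\<close> with \<open>2 ^ s\<close> elements. The term \<open>z = 0\<close> contributes the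
  field size and every other \<open>z\<close> contributes \<open>S a\<close>.\<close>

lemma card_curve: "of_nat (card (curve_points (2 ^ s) R a)) = 2 ^ n + (2 ^ s - 1) * S a"
proof -
  define f where "f x = x * (poly R x + a * x)" for x
  define K where "K = {z :: 'a. z ^ 2 ^ s = z}"
  have R_homogeneous: "poly R (w * x) = w * poly R x" if "w ^ 2 ^ s = w" for w x
  proof -
    have "w ^ (2 ^ s) ^ i = w" for i
      by (induction i) (simp_all add: power_mult that)
    then show ?thesis
      by (simp add: R_poly_def poly_sum poly_monom power_mult_distrib sum_distrib_left mult_ac)
  qed
  have zsum: "(\<Sum>x\<in>UNIV. \<psi> (z * f x)) = S a" if "z \<in> K - {0}" for z
  proof -
    obtain w where w: "w\<^sup>2 = z"
      using frob_surj_finite[OF CHAR_2, of 1] unfolding surj_def by (metis power_one_right)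
    have "(w ^ 2 ^ s) ^ 2 ^ 1 = (w\<^sup>2) ^ 2 ^ s"
      by (simp add: mult.commute flip: power_mult)
    then have "(w ^ 2 ^ s) ^ 2 ^ 1 = w ^ 2 ^ 1"
      using w that by (simp add: K_def)
    then have ws: "w ^ 2 ^ s = w"
      using frob_inj[OF CHAR_2, of 1] by (rule injD[rotated])
    have "w \<noteq> 0"
      using w that by auto
    \<comment> \<open>\<open>R\<close> is linear over \<open>K\<close>, so \<open>f\<close> scales
      by the square of \<open>w\<close>.\<close>
    have "z * f x = f (w * x)" for x
      by (simp add: f_def R_homogeneous[OF ws] w[symmetric] power2_eq_square algebra_simps)
    then have "(\<Sum>x\<in>UNIV. \<psi> (z * f x)) = (\<Sum>x\<in>UNIV. \<psi> (f (w * x)))"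
      by simp
    also have "\<dots> = (\<Sum>x\<in>UNIV. \<psi> (f x))"
      by (rule sum.reindex_bij_witness[of _ "\<lambda>x. x / w" "\<lambda>x. w * x"])
         (use \<open>w \<noteq> 0\<close> in auto)
    finally show ?thesis
      by (simp add: S_def f_def)
  qed
  have fiber: "of_nat (card {y. y ^ 2 ^ s - y = c}) = (\<Sum>z\<in>K. \<psi> (z * c))" for c
  proof -
    have "tr (z * (y ^ 2 ^ s + y)) = tr ((root 1 z + z) * y)" for y z
    proof -
      have "tr (z * y ^ 2 ^ s) = tr (root 1 z * y)"
        using frob_root_power_finite[of s 1 z]
        by (intro tr_sqrt_cong[symmetric, of _ s]) (simp add: power_mult_distrib)
      then show ?thesis
        by (simp add: distrib_left distrib_right tr_add)
    qed
    from card_fiber[OF this]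
    have "of_nat (card {y. y ^ 2 ^ s + y = c}) = (\<Sum>z | root 1 z + z = 0. \<psi> (z * c))" .
    \<comment> \<open>The adjoint of the map on \<open>y\<close> involves a root of
      \<open>z\<close>, but its kernel is again \<open>K\<close>.\<close>
    moreover have "root 1 z = z \<longleftrightarrow> z ^ 2 ^ s = z" for z
      using frob_root_power_finite[of s 1 z] frob_root_eqI[of "2 ^ s" 1 z z] frob_inj[OF CHAR_2, of s]
      by auto
    ultimately show ?thesis
      by (simp add: K_def)
  qed
  have "curve_points (2 ^ s) R a = (SIGMA x:UNIV. {y. y ^ 2 ^ s - y = f x})"
    by (auto simp: curve_points_def f_def)
  then have "of_nat (card (curve_points (2 ^ s) R a))
      = (\<Sum>x\<in>UNIV. of_nat (card {y. y ^ 2 ^ s - y = f x}) :: 'k)"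
    by (simp only: card_SigmaI finite ball_UNIV simp_thms of_nat_sum)
  also have "\<dots> = (\<Sum>z\<in>K. \<Sum>x\<in>UNIV. \<psi> (z * f x))"
    by (simp only: fiber) (rule sum.swap)
  also have "\<dots> = (\<Sum>x\<in>UNIV. \<psi> (0 * f x)) + (\<Sum>z\<in>K - {0}. \<Sum>x\<in>UNIV. \<psi> (z * f x))"
    by (rule sum.remove) (auto simp: K_def power_0_left)
  also have "\<dots> = 2 ^ n + of_nat (card (K - {0})) * S a"
    by (simp add: zsum card_UNIV)
  also have "card (K - {0}) = 2 ^ s - 1"
    using card_subfield[OF s_pos n_eq] by (simp add: K_def card_Diff_singleton power_0_left)
  finally show ?thesis
    by (simp add: of_nat_diff)
qed

end

section \<open>Evaluation of the character sums\<close>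

context additive_polynomial
begin

lemma h_eq: "n = 2 * (n div 2)"
  using n_even by simp

abbreviation M :: nat where "M \<equiv> 2 ^ (n div 2) * 2 ^ (s * e)"

lemma S_\<alpha>_value:
  "S (\<alpha> t) = (if t \<in> SF then - (\<iota> ^ (n div 2) / Q t * of_nat M) else 0)"
  by (simp add: S_\<alpha> sum_\<chi> gauss_sum[OF h_eq])

lemma two_pow_s_ge: "(2 :: nat) ^ s > 1"
  using s_pos one_less_power[of "2::nat" s] by simp

text \<open>Point counts are integers while \<open>S\<close> takes values in \<open>'k\<close>;
  characteristic 0 lets the equation pass between the two.\<close>

lemma card_curve_iff:
  "int (card (curve_points (2 ^ s) R a)) = 2 ^ n + (2 ^ s - 1) * k \<longleftrightarrow> S a = of_int k"
proof -
  have "(2 :: 'k) ^ s - 1 \<noteq> 0"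
  proof -
    have "of_nat (2 ^ s) \<noteq> (of_nat 1 :: 'k)"
      using two_pow_s_ge s_pos by (subst of_nat_eq_iff) simp
    then show ?thesis
      by simp
  qed
  have "int (card (curve_points (2 ^ s) R a)) = 2 ^ n + (2 ^ s - 1) * k
      \<longleftrightarrow> (of_int (int (card (curve_points (2 ^ s) R a))) :: 'k) = of_int (2 ^ n + (2 ^ s - 1) * k)"
    by (simp only: of_int_eq_iff)
  also have "\<dots> \<longleftrightarrow> (2 ^ s - 1) * S a = (2 ^ s - 1) * of_int k"
    by (simp add: card_curve)
  also have "\<dots> \<longleftrightarrow> S a = of_int k"
    using \<open>(2 :: 'k) ^ s - 1 \<noteq> 0\<close> by simp
  finally show ?thesis .
qed

lemma sqrt_q: "sqrt (2 ^ n) = 2 ^ (n div 2)"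
proof (rule real_sqrt_unique)
  show "(2 ^ (n div 2))\<^sup>2 = (2 ^ n :: real)"
    using n_even by (simp flip: power_mult)
qed simp

lemma T_zero_iff: "a \<in> T_zero (2 ^ s) (2 ^ n) R \<longleftrightarrow> S a = 0"
proof -
  have "a \<in> T_zero (2 ^ s) (2 ^ n) R \<longleftrightarrow> int (card (curve_points (2 ^ s) R a)) = int (2 ^ n)"
    unfolding of_nat_eq_iff by (simp add: T_zero_def)
  then show ?thesis
    using card_curve_iff[of a 0] by simp
qed

lemma real_card_curve_iff:
  "real (card (curve_points (2 ^ s) R a)) = 2 ^ n + (2 ^ s - 1) * real_of_int k
    \<longleftrightarrow> S a = of_int k"
proof -
  have "real (card (curve_points (2 ^ s) R a)) = 2 ^ n + (2 ^ s - 1) * real_of_int k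
    \<longleftrightarrow> real_of_int (int (card (curve_points (2 ^ s) R a))) = real_of_int (2 ^ n + (2 ^ s - 1) * k)"
    by simp
  then show ?thesis
    unfolding of_int_eq_iff card_curve_iff .
qed

lemma T_max_iff: "a \<in> T_max (2 ^ s) (2 ^ n) e R \<longleftrightarrow> S a = of_nat M"
  using real_card_curve_iff[of a "int M"] by (simp add: T_max_def sqrt_q mult_ac flip: power_mult)

lemma T_min_iff: "a \<in> T_min (2 ^ s) (2 ^ n) e R \<longleftrightarrow> S a = - of_nat M"
  using real_card_curve_iff[of a "- int M"] by (simp add: T_min_def sqrt_q mult_ac flip: power_mult)

text \<open>
  If the value were \<open>\<plusminus>\<iota>\<close> times \<open>\<iota> ^ (n div 2)\<close>, then the character sum, whose multiple by
  \<open>2 ^ s - 1\<close> is an integer, would be a nonzero integer multiple of \<open>\<iota>\<close>.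
\<close>
lemma Q_on_S_F:
  assumes "t \<in> SF"
  shows "Q t = \<iota> ^ (n div 2) \<or> Q t = - (\<iota> ^ (n div 2))"
proof -
  define w where "w = \<iota> ^ (n div 2) / Q t"
  have iota_4: "\<iota> ^ 4 = 1"
    using root by (simp add: primitive_4th_root_def)
  have "(\<iota> ^ (n div 2)) ^ 4 = (\<iota> ^ 4) ^ (n div 2)"
    by (simp add: mult.commute flip: power_mult)
  moreover have "Q t ^ 4 = 1"
    using Q_values[of t] iota_4 by auto
  ultimately have "w ^ 4 = 1"
    by (simp add: w_def power_divide iota_4)
  then have "(w\<^sup>2 - 1) * (w\<^sup>2 + 1) = 0"
    by (simp add: algebra_simps flip: power_add)
  then consider "w\<^sup>2 = 1" | "w\<^sup>2 = -1"
    by (auto simp: eq_neg_iff_add_eq_0)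
  then show ?thesis
  proof cases
    case 1
    then have "w = 1 \<or> w = -1"
      by (simp add: power2_eq_1_iff)
    then show ?thesis
      by (auto simp: w_def field_simps)
  next
    case 2
    define c where "c = int (card (curve_points (2 ^ s) R (\<alpha> t))) - 2 ^ n"
    define N where "N = int ((2 ^ s - 1) * M)"
    have "N \<noteq> 0"
      using two_pow_s_ge s_pos by (simp add: N_def)
    have "of_int c = (2 ^ s - 1) * S (\<alpha> t)"
      by (simp add: c_def card_curve)
    also have "\<dots> = - (w * of_int N)"
      using assms by (simp add: S_\<alpha>_value w_def N_def of_nat_diff)
    \<comment> \<open>Squaring removes \<open>w\<close>, so the relation becomes one between
      integers: a sum of two squares that vanishes although \<open>N\<close> does not.\<close>
    finally have "(of_int c :: 'k)\<^sup>2 = w\<^sup>2 * (of_int N)\<^sup>2"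
      by (simp add: power_mult_distrib)
    then have "(of_int (c\<^sup>2) :: 'k) = of_int (- (N\<^sup>2))"
      using 2 by simp
    then have "c\<^sup>2 + N\<^sup>2 = 0"
      by (simp only: of_int_eq_iff)
    then show ?thesis
      using \<open>N \<noteq> 0\<close> by (simp add: sum_power2_eq_zero_iff)
  qed
qed

section \<open>The three classes of parameters and their images\<close>

abbreviation S0 :: "'a set" where "S0 \<equiv> S_zero (2 ^ s) n e b \<xi>"
abbreviation Sminus :: "'a set" where "Sminus \<equiv> S_minus (2 ^ s) n e b \<xi> \<iota>"
abbreviation Splus :: "'a set" where "Splus \<equiv> S_plus (2 ^ s) n e b \<xi> \<iota>"

lemma iota_power_neq: "\<iota> ^ k \<noteq> - (\<iota> ^ k)"
  using iota_nonzero by simp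

lemma partition:
  "UNIV = S0 \<union> Sminus \<union> Splus" "S0 \<inter> Sminus = {}" "S0 \<inter> Splus = {}" "Sminus \<inter> Splus = {}"
  using Q_on_S_F iota_power_neq iota_nonzero
  by (auto simp: S_zero_def S_minus_def S_plus_def)

lemma S_\<alpha>_S0: "t \<in> S0 \<Longrightarrow> S (\<alpha> t) = 0"
  by (simp add: S_\<alpha>_value S_zero_def)

lemma S_\<alpha>_Sminus: "t \<in> Sminus \<Longrightarrow> S (\<alpha> t) = of_nat M"
  using iota_nonzero by (simp add: S_\<alpha>_value S_minus_def)

lemma S_\<alpha>_Splus: "t \<in> Splus \<Longrightarrow> S (\<alpha> t) = - of_nat M"
  using iota_nonzero by (simp add: S_\<alpha>_value S_plus_def)

text \<open>The sum takes the values 0, \<open>c\<close> and \<open>-c\<close> on the three classes,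
  and these are distinct. For the two equalities, a nonzero sum supplies a preimage under
  \<open>\<alpha>\<close>, and its value decides the class of that preimage.\<close>

lemma image_\<alpha>:
  "\<alpha> ` S0 \<subseteq> T_zero (2 ^ s) (2 ^ n) R"
  "\<alpha> ` Sminus = T_max (2 ^ s) (2 ^ n) e R"
  "\<alpha> ` Splus = T_min (2 ^ s) (2 ^ n) e R"
proof -
  define c :: 'k where "c = of_nat M"
  have c: "c \<noteq> 0"
    by (simp add: c_def)
  note S_values = S_\<alpha>_S0 S_\<alpha>_Sminus[folded c_def] S_\<alpha>_Splus[folded c_def]
  note T_iff = T_zero_iff T_max_iff[folded c_def] T_min_iff[folded c_def]
  have trichotomy: "t \<in> S0 \<or> t \<in> Sminus \<or> t \<in> Splus" for t
    using partition(1) by blast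
  have preimage: "\<exists>t. a = \<alpha> t" if "S a = c \<or> S a = - c" for a
    using S_nonzero_imp_range[of a] that c by auto
  show "\<alpha> ` S0 \<subseteq> T_zero (2 ^ s) (2 ^ n) R"
    using S_values(1) T_iff(1) by blast
  have "a \<in> \<alpha> ` Sminus" if a: "S a = c" for a
  proof -
    obtain t where t: "a = \<alpha> t"
      using preimage a by blast
    have "t \<in> Sminus"
      using trichotomy[of t] S_values(1,3)[of t] a c unfolding t by auto
    then show ?thesis
      using t by blast
  qed
  then show "\<alpha> ` Sminus = T_max (2 ^ s) (2 ^ n) e R"
    using S_values(2) T_iff(2) by blast
  have "a \<in> \<alpha> ` Splus" if a: "S a = - c" for a
  proof -
    obtain t where t: "a = \<alpha> t"
      using preimage a by blast
    have "t \<in> Splus"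
      using trichotomy[of t] S_values(1,2)[of t] a c unfolding t by auto
    then show ?thesis
      using t by blast
  qed
  then show "\<alpha> ` Splus = T_min (2 ^ s) (2 ^ n) e R"
    using S_values(3) T_iff(3) by blast
qed

end

theorem theorem5p11:
  fixes p q s m n e :: nat
    and b :: "nat \<Rightarrow> 'a::finite_field"
    and \<iota> :: "'k::{alg_closed_field, field_char_0}"
    and \<xi> :: "'a witt2 \<Rightarrow> 'k"
  assumes "s \<ge> 1" and "p = 2 ^ s"
    and "m \<ge> 1" and "q = p ^ m"
    and "q = 2 ^ n" and "CARD('a) = q"
    and "e \<ge> 1"
    and "b 0 * b e \<noteq> 0"
    and "F_star p e (to_ac \<circ> b) 1 = 0"
    and "W_star p e b \<subseteq> range to_ac"
    and "{x. F_star p e (to_ac \<circ> b) (poly (map_poly to_ac (F_poly p e b)) x) = 0} \<subseteq> range to_ac"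
    and "primitive_4th_root \<iota>"
    and "is_W2_F2_character \<xi>" and "\<xi> (Witt 1 0) = \<iota>"
  shows "(UNIV = S_zero p n e b \<xi> \<union> S_minus p n e b \<xi> \<iota> \<union> S_plus p n e b \<xi> \<iota> \<and>
           S_zero p n e b \<xi> \<inter> S_minus p n e b \<xi> \<iota> = {} \<and>
           S_zero p n e b \<xi> \<inter> S_plus p n e b \<xi> \<iota> = {} \<and>
           S_minus p n e b \<xi> \<iota> \<inter> S_plus p n e b \<xi> \<iota> = {}) \<and>
         (alpha_F p e b ` S_zero p n e b \<xi> \<subseteq> T_zero p q (R_poly p e b) \<and>
           alpha_F p e b ` S_minus p n e b \<xi> \<iota> = T_max p q e (R_poly p e b) \<and>
           alpha_F p e b ` S_plus p n e b \<xi> \<iota> = T_min p q e (R_poly p e b))"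
proof -
  have "(2 :: nat) ^ n = 2 ^ (s * m)"
    using assms(2,4,5) by (simp add: power_mult)
  then have "n = s * m"
    by simp
  then interpret additive_polynomial n "TYPE('a)" \<xi> \<iota> s m e b
    using assms by unfold_locales auto
  show ?thesis
    using partition image_\<alpha> assms(2,5) by (intro conjI) simp_all
qed

end
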